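(* Let $n\ge 3$ and let $C_n$ be the cycle on $n$ vertices. Then $$sn(C_n)=\begin{cases}1 & \text{if } n \text{ is even},\\ \frac{n+1}{2} & \text{otherwise.}\end{cases}$$
   Context: Graphs are finite, undirected and simple. Let $G=(V,E)$ be a connected graph with chromatic number $\chi(G)=k\ge 2$. For $S\subset V$, a partial coloring on $G[S]$ is a proper coloring $\mathscr C_0$ of the induced subgraph $G[S]$ with colors from $\{1,\dots,k\}$ (not all colors need be used). It is a Sudoku coloring of $G$ if there is exactly one proper $k$-coloring $V\to\{1,\dots,k\}$ of $G$ whose restriction to $S$ is $\mathscr C_0$. The Sudoku number $sn(G)$ is the smallest $|S|$ such that $G[S]$ admits a Sudoku coloring of $G$. *)

theory Defs
  imports "Graph_Theory.Digraph_Component" "HOL-Library.FuncSet"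
begin

text \<open>
  A finite simple undirected graph is a symmetric digraph satisfying the locale \<^locale>\<open>graph\<close>, and
  the induced subgraph \<open>G[S]\<close> is \<open>G \<restriction> S\<close>.

  Colorings are extensional functions (\<open>undefined\<close> outside the vertex set), so that two colorings
  are equal exactly when they agree on the vertices. Uniqueness of an extension relies on this.
\<close>

definition proper_coloring :: "('a, 'b) pre_digraph \<Rightarrow> nat \<Rightarrow> ('a \<Rightarrow> nat) \<Rightarrow> bool" where
  "proper_coloring G k c \<longleftrightarrow>
     c \<in> verts G \<rightarrow>\<^sub>E {1..k} \<and> (\<forall>(u, v) \<in> arcs_ends G. c u \<noteq> c v)"

definition chromatic_number :: "('a, 'b) pre_digraph \<Rightarrow> nat" where
  "chromatic_number G = (LEAST k. \<exists>c. proper_coloring G k c)"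

definition sudoku_coloring :: "('a, 'b) pre_digraph \<Rightarrow> 'a set \<Rightarrow> ('a \<Rightarrow> nat) \<Rightarrow> bool" where
  "sudoku_coloring G S c0 \<longleftrightarrow>
     S \<subseteq> verts G \<and>
     proper_coloring (G \<restriction> S) (chromatic_number G) c0 \<and>
     (\<exists>!c. proper_coloring G (chromatic_number G) c \<and> restrict c S = c0)"

text \<open>
  In a \<^locale>\<open>graph\<close> every such \<open>S\<close> is finite, so \<^const>\<open>card\<close> is the true cardinality, and both
  minima are over nonempty sets (\<open>ex_proper_coloring\<close>, \<open>ex_sudoku_coloring\<close>).
\<close>

definition sudoku_number :: "('a, 'b) pre_digraph \<Rightarrow> nat" where
  "sudoku_number G = (LEAST m. \<exists>S c0. sudoku_coloring G S c0 \<and> card S = m)"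

text \<open>Meaningful as a simple graph only for \<open>n \<ge> 3\<close>.\<close>

definition cycle_graph :: "nat \<Rightarrow> nat pair_pre_digraph" where
  "cycle_graph n =
     \<lparr> pverts = {0..<n},
       parcs = {(u, v). u < n \<and> v < n \<and> (v = Suc u mod n \<or> u = Suc v mod n)} \<rparr>"

lemma (in graph) ex_proper_coloring: "\<exists>k c. proper_coloring G k c"
proof -
  obtain f :: "'a \<Rightarrow> nat" and n where f: "f ` verts G = {i. i < n}" "inj_on f (verts G)"
    using finite_imp_inj_to_nat_seg[OF finite_verts] by auto
  define c where "c = restrict (\<lambda>v. Suc (f v)) (verts G)"
  have "f v < n" if "v \<in> verts G" for v
    using that f(1) by blast
  then have "c \<in> verts G \<rightarrow>\<^sub>E {1..n}"
    by (auto simp: c_def Suc_le_eq)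
  moreover have "c u \<noteq> c v" if "(u, v) \<in> arcs_ends G" for u v
    using that f(2) no_loops by (auto simp: c_def arcs_ends_conv inj_on_def)
  ultimately show ?thesis unfolding proper_coloring_def by blast
qed

lemma (in graph) ex_sudoku_coloring: "\<exists>S c0. sudoku_coloring G S c0"
proof -
  obtain c where c: "proper_coloring G (chromatic_number G) c"
    unfolding chromatic_number_def using LeastI_ex[OF ex_proper_coloring] by blast
  have r: "restrict d (verts G) = d" if "proper_coloring G k d" for k d
    using that by (auto simp: proper_coloring_def PiE_restrict)
  have "proper_coloring (G \<restriction> verts G) (chromatic_number G) c"
    using c by (auto simp: proper_coloring_def arcs_ends_conv)
  moreover have "\<exists>!d. proper_coloring G (chromatic_number G) d \<and> restrict d (verts G) = c"
    using c r by metis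
  ultimately show ?thesis unfolding sudoku_coloring_def by blast
qed

lemma pair_graph_cycle_graph:
  assumes "n \<ge> 3"
  shows "pair_graph (cycle_graph n)"
proof -
  have fin: "finite (parcs (cycle_graph n))"
    by (rule finite_subset[of _ "{0..<n} \<times> {0..<n}"]) (simp_all add: cycle_graph_def subset_iff)
  have loop: "u \<noteq> Suc u mod n" if "u < n" for u
    using assms that by (cases "Suc u = n") simp_all
  have arcD: "u < n \<and> v < n \<and> (v = Suc u mod n \<or> u = Suc v mod n)"
    if "(u, v) \<in> parcs (cycle_graph n)" for u v
    using that by (simp only: cycle_graph_def pair_pre_digraph.simps mem_Collect_eq case_prod_conv)
  have sym: "sym (parcs (cycle_graph n))"
    unfolding sym_def cycle_graph_def pair_pre_digraph.simps mem_Collect_eq case_prod_conv by blast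
  show ?thesis
  proof
    fix e assume e: "e \<in> parcs (cycle_graph n)"
    obtain u v where uv: "e = (u, v)" by (cases e)
    from e have "u < n" "v < n" using arcD unfolding uv by blast+
    then show "fst e \<in> pverts (cycle_graph n)" and "snd e \<in> pverts (cycle_graph n)"
      by (simp_all add: uv cycle_graph_def)
    from e arcD loop show "fst e \<noteq> snd e"
      by (metis (no_types, lifting) uv fst_conv snd_conv)
  next
    show "finite (pverts (cycle_graph n))" by (simp add: cycle_graph_def)
    show "finite (parcs (cycle_graph n))" by (rule fin)
    show "symmetric (with_proj (cycle_graph n))" using sym by (simp add: symmetric_def)
  qed
qed

lemma connected_cycle_graph:
  assumes "n \<ge> 3"
  shows "connected (with_proj (cycle_graph n))"
proof -
  let ?G = "with_proj (cycle_graph n)"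
  interpret graph ?G
    using pair_graph.pair_graphD_graph[OF pair_graph_cycle_graph[OF assms]] .
  have *: "0 \<rightarrow>\<^sup>*\<^bsub>?G\<^esub> v" if "v < n" for v
    using that
  proof (induction v)
    case 0
    then show ?case by (intro reachable_refl) (simp add: cycle_graph_def)
  next
    case (Suc v)
    have "v \<rightarrow>\<^bsub>?G\<^esub> Suc v" using Suc.prems by (simp add: cycle_graph_def)
    then show ?case using Suc by (blast intro: reachable_adj_trans Suc_lessD)
  qed
  have "v \<rightarrow>\<^sup>*\<^bsub>mk_symmetric ?G\<^esub> w" if "v < n" "w < n" for v w
    using reachable_trans[OF symmetric_reachable[OF sym_arcs *[OF that(1)]] *[OF that(2)]]
    by (simp add: reachable_mk_symmetric_eq[OF sym_arcs])
  moreover have "0 < n" using assms by simp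
  ultimately show ?thesis
    by (intro connectedI) (simp_all add: cycle_graph_def)
qed

end

theory Submission
  imports Defs
begin

text \<open>
  For even \<open>n\<close> the colors alternate, so the color of one vertex determines the coloring, while
  without prescribed colors the two colors can be exchanged.

  For odd \<open>n\<close> three colors are needed. Two adjacent vertices outside \<open>S\<close> can always be recolored
  simultaneously, so uniqueness forces the complement of \<open>S\<close> to be independent; the successor map
  then embeds it into \<open>S\<close>, whence \<open>n \<le> 2 |S|\<close>. Conversely, let \<open>S\<close> be the set of even vertices,
  colored so that \<open>v\<close> and \<open>v + 2\<close> never agree and \<open>0\<close> and \<open>n - 1\<close> do not agree: then every odd
  vertex sees two colors and is forced to take the third.
\<close>

section \<open>Sudoku colorings as restrictions of full colorings\<close>

lemma proper_coloring_induce_subgraph: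
  assumes "proper_coloring G k c" "S \<subseteq> verts G"
  shows "proper_coloring (G \<restriction> S) k (restrict c S)"
  using assms by (fastforce simp: proper_coloring_def arcs_ends_conv)

text \<open>A Sudoku coloring is the restriction of the one full coloring it determines. Together
  with \<open>sudoku_coloringE\<close> this replaces the prescribed \<open>c0\<close> by a full
  coloring \<open>c\<close> that every proper coloring agreeing with it on \<open>S\<close> must
  equal.\<close>

lemma sudoku_coloring_restrictI:
  assumes "S \<subseteq> verts G" "proper_coloring G (chromatic_number G) c"
    and "\<And>d. proper_coloring G (chromatic_number G) d \<Longrightarrow> (\<And>v. v \<in> S \<Longrightarrow> d v = c v) \<Longrightarrow> d = c"
  shows "sudoku_coloring G S (restrict c S)"
proof -
  have "d = c" if "proper_coloring G (chromatic_number G) d" "restrict d S = restrict c S" for d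
    using assms(3) that by (metis restrict_apply')
  then have "\<exists>!d. proper_coloring G (chromatic_number G) d \<and> restrict d S = restrict c S"
    using assms(2) by blast
  then show ?thesis
    using assms(1,2) proper_coloring_induce_subgraph unfolding sudoku_coloring_def by blast
qed

lemma sudoku_coloringE:
  assumes "sudoku_coloring G S c0"
  obtains c where "S \<subseteq> verts G" "proper_coloring G (chromatic_number G) c"
    "\<And>d. proper_coloring G (chromatic_number G) d \<Longrightarrow> (\<And>v. v \<in> S \<Longrightarrow> d v = c v) \<Longrightarrow> d = c"
proof -
  obtain c where c: "proper_coloring G (chromatic_number G) c" "restrict c S = c0"
    and u: "\<And>d. proper_coloring G (chromatic_number G) d \<Longrightarrow> restrict d S = c0 \<Longrightarrow> d = c"
    using assms unfolding sudoku_coloring_def by blast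
  show thesis
  proof (rule that)
    show "S \<subseteq> verts G" using assms by (simp add: sudoku_coloring_def)
    show "proper_coloring G (chromatic_number G) c" by (rule c)
    fix d assume "proper_coloring G (chromatic_number G) d" "\<And>v. v \<in> S \<Longrightarrow> d v = c v"
    then show "d = c" using u c(2) by (metis restrict_ext)
  qed
qed

lemma sudoku_number_eqI:
  assumes "sudoku_coloring G S c0" "card S = m"
    and "\<And>T d0. sudoku_coloring G T d0 \<Longrightarrow> m \<le> card T"
  shows "sudoku_number G = m"
  unfolding sudoku_number_def using assms by (intro Least_equality) blast+

section \<open>Proper colorings of a cycle\<close>

lemma proper_coloring_cycle_graph:
  "proper_coloring (with_proj (cycle_graph n)) k c \<longleftrightarrow>
    c \<in> {0..<n} \<rightarrow>\<^sub>E {1..k} \<and> (\<forall>i<n. c i \<noteq> c (Suc i mod n))"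
proof -
  have arcs: "(u, v) \<in> arcs_ends (with_proj (cycle_graph n)) \<longleftrightarrow>
      u < n \<and> v < n \<and> (v = Suc u mod n \<or> u = Suc v mod n)" for u v
    unfolding cycle_graph_def by simp
  \<comment> \<open>Each edge yields two opposite arcs, but inequality of colors is symmetric, so
    one condition per successor edge suffices.\<close>
  have "(\<forall>(u, v) \<in> arcs_ends (with_proj (cycle_graph n)). c u \<noteq> c v) \<longleftrightarrow>
      (\<forall>i<n. c i \<noteq> c (Suc i mod n))" (is "?L \<longleftrightarrow> ?R")
  proof
    assume ?L
    then have "c i \<noteq> c (Suc i mod n)" if "i < n" for i
      using arcs[of i "Suc i mod n"] that by fastforce
    then show ?R by blast
  next
    assume ?R
    then have "c u \<noteq> c v" if "(u, v) \<in> arcs_ends (with_proj (cycle_graph n))" for u v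
      using that unfolding arcs by metis
    then show ?L by blast
  qed
  moreover have "verts (with_proj (cycle_graph n)) = {0..<n}"
    by (simp add: cycle_graph_def)
  ultimately show ?thesis by (simp only: proper_coloring_def)
qed

lemma pverts_cycle_graph [simp]: "pverts (cycle_graph n) = {0..<n}"
  by (simp add: cycle_graph_def)

lemma cycle_coloring_step:
  assumes "proper_coloring (with_proj (cycle_graph n)) k c" "Suc i < n"
  shows "c i \<noteq> c (Suc i)"
  using assms by (metis Suc_lessD mod_less proper_coloring_cycle_graph)

lemma cycle_coloring_wrap:
  assumes "proper_coloring (with_proj (cycle_graph n)) k c" "n \<ge> 3"
  shows "c (n - 1) \<noteq> c 0"
proof -
  have "c (n - 1) \<noteq> c (Suc (n - 1) mod n)"
    using assms by (simp only: proper_coloring_cycle_graph) simp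
  then show ?thesis using assms(2) by simp
qed

lemma cycle_coloring_range:
  assumes "proper_coloring (with_proj (cycle_graph n)) k c" "i < n"
  shows "1 \<le> c i" "c i \<le> k"
  using assms by (auto simp: proper_coloring_cycle_graph PiE_iff)

lemma proper_coloring_cycle_graphI:
  assumes "c \<in> {0..<n} \<rightarrow>\<^sub>E {1..k}" "\<And>i. Suc i < n \<Longrightarrow> c i \<noteq> c (Suc i)" "c (n - 1) \<noteq> c 0"
  shows "proper_coloring (with_proj (cycle_graph n)) k c"
proof -
  have "c i \<noteq> c (Suc i mod n)" if "i < n" for i
    using assms(2,3) that by (cases "Suc i = n") auto
  then show ?thesis using assms(1) by (simp add: proper_coloring_cycle_graph)
qed

lemma cycle_coloring_eqI:
  assumes "proper_coloring (with_proj (cycle_graph n)) k c"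
    and "proper_coloring (with_proj (cycle_graph n)) k d" "\<And>i. i < n \<Longrightarrow> c i = d i"
  shows "c = d"
proof (rule PiE_ext)
  show "c \<in> {0..<n} \<rightarrow>\<^sub>E {1..k}" "d \<in> {0..<n} \<rightarrow>\<^sub>E {1..k}"
    using assms(1,2) by (simp_all only: proper_coloring_cycle_graph)
qed (use assms(3) in simp)

section \<open>Chromatic numbers of even and odd cycles\<close>

lemma cycle_coloring_ge_2:
  assumes "proper_coloring (with_proj (cycle_graph n)) k c" "n \<ge> 3"
  shows "2 \<le> k"
  using cycle_coloring_step[OF assms(1), of 0] cycle_coloring_range[OF assms(1), of 0]
    cycle_coloring_range[OF assms(1), of 1] assms(2) by simp

text \<open>Among the colors 1 and 2, the one different from \<open>x\<close> is
  \<open>3 - x\<close>. The induction follows the path from 0 and never uses the closing edge, so it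
  also serves to refute 2-colorings of odd cycles.\<close>

lemma cycle_2_coloring_alternates:
  assumes c: "proper_coloring (with_proj (cycle_graph n)) 2 c" and "i < n"
  shows "c i = (if even i then c 0 else 3 - c 0)"
  using \<open>i < n\<close>
proof (induction i)
  case (Suc i)
  have "1 \<le> c i" "c i \<le> 2" "1 \<le> c (Suc i)" "c (Suc i) \<le> 2" "c i \<noteq> c (Suc i)"
    using Suc.prems cycle_coloring_range[OF c] cycle_coloring_step[OF c] by simp_all
  then have "c (Suc i) = 3 - c i" by linarith
  moreover have "c 0 \<le> 2" using Suc.prems cycle_coloring_range[OF c, of 0] by simp
  ultimately show ?case using Suc by auto
qed simp

lemma chromatic_number_even_cycle:
  assumes "n \<ge> 3" "even n"
  shows "chromatic_number (with_proj (cycle_graph n)) = 2"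
  unfolding chromatic_number_def
proof (rule Least_equality)
  have "proper_coloring (with_proj (cycle_graph n)) 2
      (restrict (\<lambda>i. if even i then 1 else 2) {0..<n})"
    using assms by (intro proper_coloring_cycle_graphI) auto
  then show "\<exists>c. proper_coloring (with_proj (cycle_graph n)) 2 c" by blast
qed (use cycle_coloring_ge_2 assms in blast)

definition odd_cycle_coloring :: "nat \<Rightarrow> nat \<Rightarrow> nat" where
  "odd_cycle_coloring n = restrict (\<lambda>v. if v = n - 1 \<or> odd v \<and> v \<noteq> n - 2 then 3
     else if v mod 4 = 0 \<or> v mod 4 = 3 then 1 else 2) {0..<n}"

lemma mod_4_Suc_cases:
  fixes i :: nat
  obtains "i mod 4 = 0" "Suc i mod 4 = 1" "even i" | "i mod 4 = 1" "Suc i mod 4 = 2" "odd i"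
  | "i mod 4 = 2" "Suc i mod 4 = 3" "even i" | "i mod 4 = 3" "Suc i mod 4 = 0" "odd i"
  by atomize_elim presburger

lemma proper_coloring_odd_cycle_coloring:
  assumes "n \<ge> 3" "odd n"
  shows "proper_coloring (with_proj (cycle_graph n)) 3 (odd_cycle_coloring n)"
proof (rule proper_coloring_cycle_graphI)
  show "odd_cycle_coloring n \<in> {0..<n} \<rightarrow>\<^sub>E {1..3}"
    by (auto simp: odd_cycle_coloring_def)
  show "odd_cycle_coloring n (n - 1) \<noteq> odd_cycle_coloring n 0"
    using assms by (auto simp: odd_cycle_coloring_def)
  fix i assume i: "Suc i < n"
  \<comment> \<open>The two edges at the exceptional vertex \<open>n - 2\<close> are treated
    separately; on every other edge exactly one end has color 3.\<close>
  then consider "Suc i = n - 1" "i = n - 2" | "i \<noteq> n - 2" "Suc i = n - 2" | "i \<noteq> n - 2" "Suc i < n - 2"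
    by linarith
  then show "odd_cycle_coloring n i \<noteq> odd_cycle_coloring n (Suc i)"
    by (cases; cases i rule: mod_4_Suc_cases)
      (use assms i in \<open>auto simp: odd_cycle_coloring_def\<close>)
qed

text \<open>The residue modulo 4 alternates between 0 and 2 along the even vertices; if
  \<open>i + 2 = n - 1\<close>, its color 3 differs anyway. Hence every odd vertex has neighbors of
  two different colors.\<close>

lemma odd_cycle_coloring_two_apart:
  assumes "odd n" "even i" "i + 2 < n"
  shows "odd_cycle_coloring n i \<noteq> odd_cycle_coloring n (i + 2)"
proof -
  have "i \<noteq> n - 1" "i \<noteq> n - 2" using assms by presburger+
  moreover have "i mod 4 = 0 \<and> (i + 2) mod 4 = 2 \<or> i mod 4 = 2 \<and> (i + 2) mod 4 = 0"
    using assms(2) by presburger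
  ultimately show ?thesis using assms by (auto simp: odd_cycle_coloring_def)
qed

lemma chromatic_number_odd_cycle:
  assumes "n \<ge> 3" "odd n"
  shows "chromatic_number (with_proj (cycle_graph n)) = 3"
  unfolding chromatic_number_def
proof (rule Least_equality)
  show "\<exists>c. proper_coloring (with_proj (cycle_graph n)) 3 c"
    using proper_coloring_odd_cycle_coloring[OF assms] by blast
  fix k assume "\<exists>c. proper_coloring (with_proj (cycle_graph n)) k c"
  then obtain c where c: "proper_coloring (with_proj (cycle_graph n)) k c" by blast
  \<comment> \<open>As \<open>n - 1\<close> is even, alternation would give it the color of its
    neighbor 0.\<close>
  have "k \<noteq> 2"
    using c cycle_2_coloring_alternates[of n c "n - 1"] cycle_coloring_wrap[of n k c] assms by auto
  then show "3 \<le> k" using cycle_coloring_ge_2[OF c assms(1)] by simp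
qed

section \<open>Lower bound for odd cycles\<close>

lemma Suc_mod_inj_on: "inj_on (\<lambda>i. Suc i mod n) {0..<n}"
  by (rule inj_onI) (auto simp: mod_Suc split: if_splits)

text \<open>Only the edges from \<open>p\<close> to \<open>u\<close>, from \<open>u\<close> to
  \<open>v\<close> and from \<open>v\<close> onward are affected, and the last three assumptions
  cover exactly these.\<close>

lemma recolor_adjacent:
  assumes c: "proper_coloring (with_proj (cycle_graph n)) k c" and "n \<ge> 3"
    and "p < n" and u: "u = Suc p mod n" and v: "v = Suc u mod n"
    and "a \<in> {1..k}" "b \<in> {1..k}" "a \<noteq> b" "a \<noteq> c p" "b \<noteq> c (Suc v mod n)"
  shows "proper_coloring (with_proj (cycle_graph n)) k (c(u := a, v := b))"
  unfolding proper_coloring_cycle_graph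
proof (intro conjI allI impI)
  have uv: "u < n" "v < n" using u v \<open>n \<ge> 3\<close> by auto
  then show "c(u := a, v := b) \<in> {0..<n} \<rightarrow>\<^sub>E {1..k}"
    using c assms(6,7) by (auto simp: proper_coloring_cycle_graph PiE_iff extensional_def)
  have ne: "u \<noteq> v" "Suc v mod n \<noteq> v" "Suc v mod n \<noteq> u"
    using uv v \<open>n \<ge> 3\<close> by (auto simp: mod_Suc split: if_splits)
  fix i assume "i < n"
  \<comment> \<open>Injectivity of the successor map: the only edges ending in \<open>u\<close> and
    \<open>v\<close> start at \<open>p\<close> and \<open>u\<close>.\<close>
  then have "Suc i mod n = u \<Longrightarrow> i = p" "Suc i mod n = v \<Longrightarrow> i = u"
    using inj_onD[OF Suc_mod_inj_on, of i n p] inj_onD[OF Suc_mod_inj_on, of i n u]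
      u v uv(1) \<open>p < n\<close> by (metis atLeastLessThan_iff zero_le)+
  note pred = this
  have ci: "c i \<noteq> c (Suc i mod n)"
    using c \<open>i < n\<close> by (simp add: proper_coloring_cycle_graph)
  consider "i = u" | "i = v" | "i \<noteq> u" "i \<noteq> v" by blast
  then show "(c(u := a, v := b)) i \<noteq> (c(u := a, v := b)) (Suc i mod n)"
  proof cases
    case 1
    then show ?thesis using ne(1) \<open>a \<noteq> b\<close> by (simp add: v[symmetric])
  next
    case 2
    then show ?thesis using ne(2,3) assms(10) by simp
  next
    case 3
    then have "Suc i mod n \<noteq> v" using pred(2) by blast
    then show ?thesis using 3 pred(1) ci \<open>a \<noteq> c p\<close> by (cases "Suc i mod n = u") auto
  qed
qed

text \<open>The three colors sum to 6.\<close>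

lemma eq_third_color:
  fixes a b c :: nat
  assumes "a \<in> {1..3}" "b \<in> {1..3}" "c \<in> {1..3}" "a \<noteq> b" "a \<noteq> c" "b \<noteq> c"
  shows "c = 6 - a - b"
proof -
  have "a = 1 \<or> a = 2 \<or> a = 3" "b = 1 \<or> b = 2 \<or> b = 3" "c = 1 \<or> c = 2 \<or> c = 3"
    using assms(1-3) by auto
  then show ?thesis using assms(4-6) by auto
qed

lemma third_color:
  fixes a b :: nat
  obtains c where "c \<in> {1..3}" "c \<noteq> a" "c \<noteq> b"
proof -
  have "card ({1..3} - {a, b}) \<ge> 1"
    using diff_card_le_card_Diff[of "{a, b}" "{1..3}"] by (simp add: card_insert_if split: if_splits)
  then have "{1..3} - {a, b} \<noteq> {}" by (metis card.empty not_one_le_zero)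
  then show thesis using that by blast
qed

text \<open>Here \<open>x, a, b, y\<close> are the colors along a path whose inner vertices are
  recolored. Swapping \<open>a\<close> and \<open>b\<close> works unless \<open>b = x\<close> or
  \<open>a = y\<close>; then the third color can replace \<open>a\<close> or \<open>b\<close>,
  respectively.\<close>

lemma ex_other_pair:
  fixes x y a b :: nat
  assumes "a \<in> {1..3}" "b \<in> {1..3}" "a \<noteq> b" "x \<noteq> a" "b \<noteq> y"
  obtains a' b' where "a' \<in> {1..3}" "b' \<in> {1..3}" "a' \<noteq> b'" "a' \<noteq> x" "b' \<noteq> y"
    "a' \<noteq> a \<or> b' \<noteq> b"
proof -
  obtain e where e: "e \<in> {1..3}" "e \<noteq> a" "e \<noteq> b" using third_color .
  consider "b = x" | "a = y" | "b \<noteq> x" "a \<noteq> y" by blast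
  then show thesis
  proof cases
    case 1
    then show thesis using that[of e b] assms e by blast
  next
    case 2
    then show thesis using that[of a e] assms e by blast
  next
    case 3
    then show thesis using that[of b a] assms by blast
  qed
qed

lemma card_sudoku_odd_cycle:
  assumes "n \<ge> 3" "odd n" and S: "sudoku_coloring (with_proj (cycle_graph n)) S c0"
  shows "n \<le> 2 * card S"
proof -
  note chi = chromatic_number_odd_cycle[OF assms(1,2)]
  obtain c where S: "S \<subseteq> {0..<n}" and c: "proper_coloring (with_proj (cycle_graph n)) 3 c"
    and uniq: "\<And>d. proper_coloring (with_proj (cycle_graph n)) 3 d \<Longrightarrow>
      (\<And>v. v \<in> S \<Longrightarrow> d v = c v) \<Longrightarrow> d = c"
    using sudoku_coloringE[OF S] unfolding chi with_proj_simps pverts_cycle_graph by metis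
  have "Suc u mod n \<in> S" if "u < n" "u \<notin> S" for u
  proof (rule ccontr)
    define v where "v = Suc u mod n"
    assume "Suc u mod n \<notin> S"
    then have "v \<notin> S" by (simp add: v_def)
    define p where "p = (if u = 0 then n - 1 else u - 1)"
    have p: "p < n" "u = Suc p mod n" using \<open>u < n\<close> \<open>n \<ge> 3\<close> by (auto simp: p_def)
    have "v < n" using \<open>n \<ge> 3\<close> by (simp add: v_def)
    have "u \<noteq> v" using v_def \<open>u < n\<close> \<open>n \<ge> 3\<close> by (auto simp: mod_Suc split: if_splits)
    have adj: "c i \<noteq> c (Suc i mod n)" if "i < n" for i
      using c that by (simp add: proper_coloring_cycle_graph)
    obtain a b where ab: "a \<in> {1..3}" "b \<in> {1..3}" "a \<noteq> b" "a \<noteq> c p" "b \<noteq> c (Suc v mod n)"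
      and ne: "a \<noteq> c u \<or> b \<noteq> c v"
      using ex_other_pair[of "c u" "c v" "c p" "c (Suc v mod n)"]
        cycle_coloring_range[OF c \<open>u < n\<close>] cycle_coloring_range[OF c \<open>v < n\<close>]
        adj[OF p(1)] adj[OF \<open>u < n\<close>] adj[OF \<open>v < n\<close>] p(2) v_def
      by (metis atLeastAtMost_iff)
    \<comment> \<open>The recoloring changes nothing on \<open>S\<close>, so uniqueness would make
      it equal to \<open>c\<close>, although it differs at \<open>u\<close> or
      \<open>v\<close>.\<close>
    have "c(u := a, v := b) = c"
      using recolor_adjacent[OF c \<open>n \<ge> 3\<close> p v_def ab] \<open>u \<notin> S\<close> \<open>v \<notin> S\<close> by (intro uniq) auto
    then show False using ne \<open>u \<noteq> v\<close> by (metis fun_upd_apply)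
  qed
  then have "(\<lambda>i. Suc i mod n) ` ({0..<n} - S) \<subseteq> S" by auto
  then have "card ({0..<n} - S) \<le> card S"
    using finite_subset[OF S] by (intro card_inj_on_le[OF inj_on_subset[OF Suc_mod_inj_on]]) auto
  moreover have "card ({0..<n} - S) = n - card S"
    using S by (simp add: card_Diff_subset finite_subset)
  ultimately show ?thesis by linarith
qed

section \<open>Upper bound for odd cycles\<close>

lemma sudoku_coloring_odd_cycle:
  assumes "n \<ge> 3" "odd n"
  shows "sudoku_coloring (with_proj (cycle_graph n)) {i. i < n \<and> even i}
    (restrict (odd_cycle_coloring n) {i. i < n \<and> even i})"
proof (rule sudoku_coloring_restrictI, unfold chromatic_number_odd_cycle[OF assms])
  let ?c = "odd_cycle_coloring n"
  show c: "proper_coloring (with_proj (cycle_graph n)) 3 ?c"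
    by (rule proper_coloring_odd_cycle_coloring[OF assms])
  fix d assume d: "proper_coloring (with_proj (cycle_graph n)) 3 d"
    and eq: "\<And>v. v \<in> {i. i < n \<and> even i} \<Longrightarrow> d v = ?c v"
  show "d = ?c"
  proof (rule cycle_coloring_eqI[OF d c])
    fix i assume "i < n"
    show "d i = ?c i"
    proof (cases "even i")
      case False
      then obtain j where j: "i = Suc j" "even j" by (cases i) auto
      \<comment> \<open>Since \<open>n\<close> is odd, an odd vertex is never the last one, so both
        its neighbors are even vertices reached without wrapping around.\<close>
      then have lt: "Suc (Suc j) < n" using \<open>i < n\<close> assms(2) by presburger
      have "d j = ?c j" "d (Suc (Suc j)) = ?c (Suc (Suc j))"
        using eq j lt by simp_all
      moreover have "?c j \<noteq> ?c (Suc (Suc j))"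
        using odd_cycle_coloring_two_apart[OF assms(2) j(2)] lt by simp
      \<comment> \<open>Stated for arbitrary \<open>f\<close>, so that \<open>d\<close> and the
        given coloring are computed by the same formula from equal neighbor colors.\<close>
      moreover have third: "f (Suc j) = 6 - f j - f (Suc (Suc j))"
        if "proper_coloring (with_proj (cycle_graph n)) 3 f" "f j \<noteq> f (Suc (Suc j))" for f
      proof (rule eq_third_color)
        show "f j \<in> {1..3}" "f (Suc (Suc j)) \<in> {1..3}" "f (Suc j) \<in> {1..3}"
          using cycle_coloring_range[OF that(1)] lt by simp_all
        show "f j \<noteq> f (Suc j)" "f (Suc (Suc j)) \<noteq> f (Suc j)"
          using cycle_coloring_step[OF that(1), of j] cycle_coloring_step[OF that(1), of "Suc j"] lt
          by simp_all
      qed (rule that)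
      ultimately have "d (Suc j) = ?c (Suc j)" using third[OF c] third[OF d] by simp
      then show ?thesis by (simp add: j)
    qed (use eq \<open>i < n\<close> in simp)
  qed
qed auto

lemma card_even_lessThan_odd:
  assumes "odd n"
  shows "card {i. i < n \<and> even i} = (n + 1) div 2"
proof -
  have "{i. i < n \<and> even i} = (\<lambda>j. 2 * j) ` {0..<(n + 1) div 2}"
    using assms by (auto elim!: evenE oddE)
  then show ?thesis by (simp add: card_image inj_on_def)
qed

section \<open>Even cycles\<close>

lemma sudoku_coloring_even_cycle:
  assumes "n \<ge> 3" "even n"
  shows "\<exists>c0. sudoku_coloring (with_proj (cycle_graph n)) {0} c0"
proof -
  note chi = chromatic_number_even_cycle[OF assms]
  interpret graph "with_proj (cycle_graph n)"
    using pair_graph.pair_graphD_graph[OF pair_graph_cycle_graph[OF assms(1)]] .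
  have "\<exists>c. proper_coloring (with_proj (cycle_graph n))
      (chromatic_number (with_proj (cycle_graph n))) c"
    unfolding chromatic_number_def by (rule LeastI_ex[OF ex_proper_coloring])
  then obtain c where c: "proper_coloring (with_proj (cycle_graph n)) 2 c"
    unfolding chi by blast
  have "d = c" if d: "proper_coloring (with_proj (cycle_graph n)) 2 d" "d 0 = c 0" for d
    using cycle_2_coloring_alternates[OF d(1)] cycle_2_coloring_alternates[OF c] d(2)
    by (metis cycle_coloring_eqI[OF d(1) c])
  then have "sudoku_coloring (with_proj (cycle_graph n)) {0} (restrict c {0})"
    using c assms by (intro sudoku_coloring_restrictI) (auto simp: chi)
  then show ?thesis by blast
qed

lemma sudoku_coloring_even_cycle_nonempty:
  assumes "n \<ge> 3" "even n" and S: "sudoku_coloring (with_proj (cycle_graph n)) S c0"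
  shows "S \<noteq> {}"
proof
  assume "S = {}"
  note chi = chromatic_number_even_cycle[OF assms(1,2)]
  obtain c where c: "proper_coloring (with_proj (cycle_graph n)) 2 c"
    and uniq: "\<And>d. proper_coloring (with_proj (cycle_graph n)) 2 d \<Longrightarrow> d = c"
    using sudoku_coloringE[OF S] unfolding chi \<open>S = {}\<close> by (metis empty_iff)
  \<comment> \<open>The coloring with 1 and 2 exchanged, which would have to coincide with
    \<open>c\<close>.\<close>
  let ?d = "restrict (\<lambda>i. 3 - c i) {0..<n}"
  have sw: "3 - c i \<in> {1..2}" "3 - c i = 3 - c j \<longleftrightarrow> c i = c j" if "i < n" "j < n" for i j
    using cycle_coloring_range[OF c that(1)] cycle_coloring_range[OF c that(2)] by auto
  have "proper_coloring (with_proj (cycle_graph n)) 2 ?d"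
  proof (rule proper_coloring_cycle_graphI)
    show "?d \<in> {0..<n} \<rightarrow>\<^sub>E {1..2}" using sw(1) by fastforce
    show "?d i \<noteq> ?d (Suc i)" if "Suc i < n" for i
      using that sw(2) cycle_coloring_step[OF c that] by simp
    show "?d (n - 1) \<noteq> ?d 0"
      using assms(1) sw(2) cycle_coloring_wrap[OF c assms(1)] by simp
  qed
  then have "?d 0 = c 0" by (rule uniq[THEN fun_cong])
  then have "3 - c 0 = c 0" using assms(1) by simp
  \<comment> \<open>The equation has no solution in the naturals, even with truncated
    subtraction.\<close>
  then show False by presburger
qed

theorem theorem3p5:
  fixes n :: nat
  assumes "n \<ge> 3"
  shows "sudoku_number (with_proj (cycle_graph n)) = (if even n then 1 else (n + 1) div 2)"
proof (cases "even n")
  case True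
  obtain c0 where c0: "sudoku_coloring (with_proj (cycle_graph n)) {0} c0"
    using sudoku_coloring_even_cycle[OF assms True] by blast
  have "1 \<le> card T" if "sudoku_coloring (with_proj (cycle_graph n)) T d0" for T d0
  proof -
    \<comment> \<open>This makes \<open>T\<close> finite; nonemptiness alone would not give
      \<open>1 \<le> card T\<close>, since infinite sets have \<open>card\<close> 0.\<close>
    have "T \<subseteq> {0..<n}" using that by (simp add: sudoku_coloring_def)
    then show ?thesis
      using sudoku_coloring_even_cycle_nonempty[OF assms True that] finite_subset
      by (fastforce simp: Suc_le_eq card_gt_0_iff)
  qed
  then show ?thesis using sudoku_number_eqI[OF c0] True by simp
next
  case False
  \<comment> \<open>From \<open>n \<le> 2 * card T\<close> by rounding \<open>n / 2\<close>
    up.\<close>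
  have "(n + 1) div 2 \<le> card T" if "sudoku_coloring (with_proj (cycle_graph n)) T d0" for T d0
    using card_sudoku_odd_cycle[OF assms False that] by linarith
  then show ?thesis
    using sudoku_number_eqI[OF sudoku_coloring_odd_cycle[OF assms False]
        card_even_lessThan_odd[OF False]] False by simp
qed

end
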